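(* Let $n\ge1$ and $1\le p\le n$. A permutation $\pi\in S_n$ lies in $\bigcap_{r=1}^{n+1}\mathcal{T}_n^{(r,p)}$ if and only if $p+i-n\le \pi^{-1}_i\le p+i-1$ for all $1\le i\le n$. Further, the number of such permutations is $C_{p,n-p}$.
   Context: Sites are the integers $0,\dots,n+1$. A configuration in $\mathcal{S}(n,p)$ places $n+1$ distinct chips labeled $1,\dots,n+1$ with sites $0,n+1$ empty, one chip at each site of $\{1,\dots,n\}\setminus\{p\}$ and two chips at site $p$. Toppling: while some site holds at least two chips, choose such a site $i$ and two chips $\alpha<\beta$ there and move $\alpha$ to $i-1$, $\beta$ to $i+1$. It is known this terminates with at most one chip per site within sites $0,\dots,n+1$ and that the final configuration is independent of the choices; reading labels left to right gives a permutation of $[n+1]$. For $\pi\in S_n$, $r\in[n+1]$, $\pi^{(r,p)}$ places at site $i$ ($1\le i\le n$) chip $\pi_i$ if $\pi_i<r$ and $\pi_i+1$ otherwise, plus chip $r$ at site $p$. $\mathcal{T}_n^{(r,p)}$ is the set of $\pi\in S_n$ for which toppling $\pi^{(r,p)}$ gives the identity. $\pi^{-1}_i$ denotes the position of $i$ in $\pi$. Poly-Bernoulli numbers of type C are here $C_{n,k}=\sum_{m=0}^{\min(n,k)}(m!)^2\left\{{n+1\atop m+1}\right\}\left\{{k\atop m}\right\}$ (Stirling numbers of the second kind), so that $C_{n,0}=1$ for $n\ge0$ and $C_{0,k}=0$ for $k\ge1$. *)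

theory Defs
  imports "HOL-Combinatorics.Combinatorics"
begin

text \<open>A chip configuration: each (integer) site holds a finite set of labelled chips.\<close>
type_synonym config = "int \<Rightarrow> nat set"

definition topple_step :: "config \<Rightarrow> config \<Rightarrow> bool" where
  "topple_step c c' \<longleftrightarrow>
     (\<exists>i a b. 2 \<le> card (c i) \<and> a \<in> c i \<and> b \<in> c i \<and> a < b \<and>
        c' = c(i := c i - {a, b}, i - 1 := insert a (c (i - 1)), i + 1 := insert b (c (i + 1))))"

definition stable :: "config \<Rightarrow> bool" where
  "stable c \<longleftrightarrow> (\<forall>i. card (c i) \<le> 1)"

definition reads_identity :: "config \<Rightarrow> bool" where
  "reads_identity c \<longleftrightarrow> (\<forall>i j a b. a \<in> c i \<longrightarrow> b \<in> c j \<longrightarrow> a < b \<longrightarrow> i < j)"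

definition topples_to_identity :: "config \<Rightarrow> bool" where
  "topples_to_identity c \<longleftrightarrow>
     (\<exists>c'. topple_step\<^sup>*\<^sup>* c c' \<and> stable c' \<and> reads_identity c')"

definition init_config :: "nat \<Rightarrow> (nat \<Rightarrow> nat) \<Rightarrow> nat \<Rightarrow> nat \<Rightarrow> config" where
  "init_config n \<pi> r p = (\<lambda>s.
     (if 1 \<le> s \<and> s \<le> int n then {if \<pi> (nat s) < r then \<pi> (nat s) else \<pi> (nat s) + 1} else {})
     \<union> (if s = int p then {r} else {}))"

definition T_set :: "nat \<Rightarrow> nat \<Rightarrow> nat \<Rightarrow> (nat \<Rightarrow> nat) set" where
  "T_set n r p = {\<pi>. \<pi> permutes {1..n} \<and> topples_to_identity (init_config n \<pi> r p)}"

definition polyC :: "nat \<Rightarrow> nat \<Rightarrow> nat" where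
  "polyC n k = (\<Sum>m\<le>min n k. (fact m)^2 * Stirling (n + 1) (m + 1) * Stirling k m)"

end

theory Submission
  imports Defs
begin

text \<open>
  Let \<open>v y\<close> be the number of topplings at site \<open>y\<close> plus \<open>max 0 (y - p)\<close>. Whatever the order of
  topplings, \<open>v\<close> is nondecreasing with steps 0 or 1, and site \<open>x\<close> can topple only if
  \<open>v (x - 1) = v x\<close> and \<open>v (x + 1) = v x + 1\<close>, after which \<open>v x\<close> grows by one; at the end
  \<open>v y = min y (n + 1 - p)\<close>. Hence the inequality \<open>k \<le> v (position of chip k)\<close> persists once it
  holds, and in the final configuration it contradicts the identity. Conversely, if it fails for
  every chip at the start, then at all times at most \<open>max 0 (k - v y)\<close> of the chips \<open>1, ..., k\<close>
  are at sites \<open>\<ge> y\<close>, so that finally the chips \<open>k \<le> n + 1 - p\<close> are at sites below \<open>k\<close>. Together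
  with the mirror images of these two facts, this shows that the process sorts the chips iff every
  chip \<open>k\<close> starts between \<open>p + k - n - 1\<close> and \<open>p + k - 1\<close>. The values \<open>r = n + 1\<close> and \<open>r = 1\<close>
  give the strongest upper and lower bounds on \<open>\<pi>\<close>.

  For the enumeration, the forbidden positions of the permutation matrix form two staircases in
  opposite corners. The remaining corner cells are staircase boards, whose rook numbers are Stirling
  numbers \<open>S(q, m)\<close> and \<open>S(p + 1, m + 1)\<close>, where \<open>q = n - p\<close>, and the other two blocks of the
  matrix are unrestricted and contribute \<open>m!\<close> each.
\<close>

section \<open>Heights of chip configurations\<close>

text \<open>Labels are distinct, so it suffices to record the site of each label; a toppling is then
  the two-point update \<open>fire\<close>.\<close>

definition cfg :: "nat \<Rightarrow> (nat \<Rightarrow> int) \<Rightarrow> config" where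
  "cfg N f = (\<lambda>s. {k \<in> {1..N}. f k = s})"

lemma finite_cfg [simp]: "finite (cfg N f s)"
  by (simp add: cfg_def)

abbreviation fire :: "(nat \<Rightarrow> int) \<Rightarrow> nat \<Rightarrow> nat \<Rightarrow> nat \<Rightarrow> int" where
  "fire f a b \<equiv> f(a := f a - 1, b := f b + 1)"

lemma cfg_fire:
  assumes "a \<in> {1..N}" "b \<in> {1..N}" "a < b" "f a = f b"
  shows "cfg N (fire f a b) =
    (cfg N f)(f a := cfg N f (f a) - {a, b}, f a - 1 := insert a (cfg N f (f a - 1)),
              f a + 1 := insert b (cfg N f (f a + 1)))"
  using assms by (auto simp: cfg_def fun_eq_iff)

lemma topple_step_cfgE:
  assumes "topple_step (cfg N f) c"
  obtains a b where "a \<in> {1..N}" "b \<in> {1..N}" "a < b" "f a = f b" "c = cfg N (fire f a b)"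
proof -
  obtain i a b where *: "a \<in> cfg N f i" "b \<in> cfg N f i" "a < b"
      "c = (cfg N f)(i := cfg N f i - {a, b}, i - 1 := insert a (cfg N f (i - 1)),
              i + 1 := insert b (cfg N f (i + 1)))"
    using assms unfolding topple_step_def by auto
  then have "a \<in> {1..N}" "b \<in> {1..N}" "f a = i" "f b = i"
    by (auto simp: cfg_def)
  with * show thesis using cfg_fire[of a N b f] by (intro that[of a b]) simp_all
qed

lemma crowdedI:
  assumes "a \<in> {1..N}" "b \<in> {1..N}" "a < b" "f a = f b"
  shows "2 \<le> card (cfg N f (f a))"
proof -
  have "{a, b} \<subseteq> cfg N f (f a)" using assms by (auto simp: cfg_def)
  then have "card {a, b} \<le> card (cfg N f (f a))" by (intro card_mono) auto
  then show ?thesis using assms(3) by simp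
qed

lemma topple_step_cfgI:
  assumes "a \<in> {1..N}" "b \<in> {1..N}" "a < b" "f a = f b"
  shows "topple_step (cfg N f) (cfg N (fire f a b))"
  unfolding topple_step_def cfg_fire[OF assms] using assms crowdedI[of a N b f]
  by (intro exI[of _ "f a"] exI[of _ a] exI[of _ b]) (auto simp: cfg_def)

text \<open>The change is the second difference of the indicator of the toppled site, so raising the
  height there by one keeps the count formula of \<open>height_inv\<close>.\<close>

lemma card_cfg_fire:
  assumes "a \<in> {1..N}" "b \<in> {1..N}" "a < b" "f a = f b"
  shows "int (card (cfg N (fire f a b) y)) = int (card (cfg N f y))
     - (if y = f a then 2 else 0) + (if y = f a - 1 then 1 else 0) + (if y = f a + 1 then 1 else 0)"
proof -
  have sub: "{a, b} \<subseteq> cfg N f (f a)" using assms by (auto simp: cfg_def)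
  then have "card {a, b} \<le> card (cfg N f (f a))" by (intro card_mono) auto
  moreover have "card (cfg N f (f a) - {a, b}) = card (cfg N f (f a)) - card {a, b}"
    using sub by (intro card_Diff_subset) auto
  moreover have "a \<notin> cfg N f (f a - 1)" "b \<notin> cfg N f (f a + 1)"
    using assms by (auto simp: cfg_def)
  ultimately show ?thesis
    unfolding cfg_fire[OF assms] using assms(3) by auto
qed

text \<open>
  The height of site \<open>y\<close> is its number of topplings so far plus \<open>max 0 (y - p)\<close>, continued
  outside \<open>{0..n + 1}\<close> so that sites \<open>0\<close> and \<open>n + 1\<close> obey the same second-difference formula
  for the number of chips. A site can topple only where the increments of \<open>v\<close> read \<open>0, 1\<close>, and
  toppling turns them into \<open>1, 0\<close>.
\<close>

definition height_inv :: "nat \<Rightarrow> nat \<Rightarrow> (nat \<Rightarrow> int) \<Rightarrow> (int \<Rightarrow> int) \<Rightarrow> bool" where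
  "height_inv n p f v \<longleftrightarrow>
     (\<forall>y\<le>0. v y = y) \<and> (\<forall>y\<ge>int n + 1. v y = int n + 1 - int p) \<and>
     (\<forall>y. v y \<le> v (y + 1) \<and> v (y + 1) \<le> v y + 1) \<and>
     (\<forall>y. int (card (cfg (n + 1) f y)) =
            (if 0 \<le> y \<and> y \<le> int n + 1 then 1 else 0) + v (y + 1) + v (y - 1) - 2 * v y)"

lemma height_invD:
  assumes "height_inv n p f v"
  shows "y \<le> 0 \<Longrightarrow> v y = y" "y \<ge> int n + 1 \<Longrightarrow> v y = int n + 1 - int p"
    "v y \<le> v (y + 1)" "v (y + 1) \<le> v y + 1" "v (y - 1) \<le> v y" "v y \<le> v (y - 1) + 1"
    "int (card (cfg (n + 1) f y)) =
            (if 0 \<le> y \<and> y \<le> int n + 1 then 1 else 0) + v (y + 1) + v (y - 1) - 2 * v y"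
proof -
  have "v (y - 1) \<le> v (y - 1 + 1) \<and> v (y - 1 + 1) \<le> v (y - 1) + 1"
    using assms unfolding height_inv_def by blast
  then show "v (y - 1) \<le> v y" "v y \<le> v (y - 1) + 1" by simp_all
qed (use assms in \<open>auto simp: height_inv_def\<close>)

text \<open>A count is at most 1 plus the right increment of \<open>v\<close> minus the left one.
  Increments are 0 or 1, so two chips force left 0 and right 1; the prescribed heights exclude this
  at sites \<open>0\<close> and \<open>n + 1\<close>.\<close>

lemma height_at_crowded_site:
  assumes h: "height_inv n p f v" and crowded: "2 \<le> card (cfg (n + 1) f x)"
  shows "v (x - 1) = v x" "v (x + 1) = v x + 1" "0 < x" "x < int n + 1"
proof -
  note D = height_invD[OF h, of x]
  have "x \<ge> 0" "x \<le> int n + 1" "v (x - 1) = v x" "v (x + 1) = v x + 1"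
    using D(3-7) crowded by (auto split: if_splits)
  moreover from this have "x \<noteq> 0" "x \<noteq> int n + 1"
    using height_invD(1)[OF h, of x] height_invD(1)[OF h, of "x - 1"]
      height_invD(2)[OF h, of x] height_invD(2)[OF h, of "x + 1"] by auto
  ultimately show "v (x - 1) = v x" "v (x + 1) = v x + 1" "0 < x" "x < int n + 1" by auto
qed

text \<open>The increment pattern leaves exactly two chips at a crowded site.\<close>

lemma crowded_site_eq:
  assumes h: "height_inv n p f v"
    and ab: "a \<in> {1..n+1}" "b \<in> {1..n+1}" "a < b" "f a = f b"
    and j: "j \<in> {1..n+1}" "f j = f a"
  shows "j = a \<or> j = b"
proof -
  have "card (cfg (n + 1) f (f a)) = 2"
    using height_at_crowded_site[OF h crowdedI[OF ab]] height_invD(7)[OF h, of "f a"] by auto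
  moreover have "{a, b} \<subseteq> cfg (n + 1) f (f a)" using ab by (auto simp: cfg_def)
  ultimately have "{a, b} = cfg (n + 1) f (f a)" using ab by (intro card_subset_eq) auto
  then show ?thesis using j by (auto simp: cfg_def)
qed

lemma height_inv_fire:
  assumes h: "height_inv n p f v"
    and ab: "a \<in> {1..n+1}" "b \<in> {1..n+1}" "a < b" "f a = f b"
  shows "height_inv n p (fire f a b) (v(f a := v (f a) + 1))"
proof -
  let ?x = "f a" and ?w = "v(f a := v (f a) + 1)"
  note X = height_at_crowded_site[OF h crowdedI[OF ab]]
  have "?w y = y" if "y \<le> 0" for y using X height_invD(1)[OF h that] that by auto
  moreover have "?w y = int n + 1 - int p" if "y \<ge> int n + 1" for y
    using X height_invD(2)[OF h that] that by auto
  moreover have "?w y \<le> ?w (y + 1) \<and> ?w (y + 1) \<le> ?w y + 1" for y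
    using X height_invD(3,4)[OF h, of y] by (cases "y = ?x"; cases "y = ?x - 1") auto
  moreover have "int (card (cfg (n + 1) (fire f a b) y)) =
      (if 0 \<le> y \<and> y \<le> int n + 1 then 1 else 0) + ?w (y + 1) + ?w (y - 1) - 2 * ?w y" for y
    unfolding card_cfg_fire[OF ab] height_invD(7)[OF h, of y] by auto
  ultimately show ?thesis unfolding height_inv_def by blast
qed

text \<open>Heights are carried along existentially, and the step obligation receives the increment
  pattern at the toppled site, so each later invariant needs only a one-step check.\<close>

lemma reachable_invariant:
  assumes "topple_step\<^sup>*\<^sup>* (cfg (n + 1) f) c" "height_inv n p f v" "Q f v"
    and step: "\<And>f v a b. height_inv n p f v \<Longrightarrow> Q f v \<Longrightarrow> a \<in> {1..n+1} \<Longrightarrow> b \<in> {1..n+1} \<Longrightarrow> a < b \<Longrightarrow>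
      f a = f b \<Longrightarrow> v (f a - 1) = v (f a) \<Longrightarrow> v (f a + 1) = v (f a) + 1 \<Longrightarrow>
      Q (fire f a b) (v(f a := v (f a) + 1))"
  shows "\<exists>g w. c = cfg (n + 1) g \<and> height_inv n p g w \<and> Q g w"
  using assms(1)
proof (induction rule: rtranclp_induct)
  case base
  then show ?case using assms(2,3) by blast
next
  case (step c d)
  then obtain g w where g: "c = cfg (n + 1) g" "height_inv n p g w" "Q g w" by blast
  with step obtain a b where ab: "a \<in> {1..n+1}" "b \<in> {1..n+1}" "a < b" "g a = g b"
      "d = cfg (n + 1) (fire g a b)"
    by (auto elim: topple_step_cfgE)
  with g show ?case
    using height_inv_fire[OF g(2) ab(1-4)] assms(4)[OF g(2,3) ab(1-4)]
      height_at_crowded_site[OF g(2) crowdedI[OF ab(1-4)]] by blast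
qed

section \<open>Final heights and termination\<close>

lemma height_le:
  assumes h: "height_inv n p f v" and "0 \<le> y" "y \<le> int n + 1"
  shows "v y \<le> y" "v y \<le> int n + 1 - int p"
proof -
  show "v y \<le> y" using \<open>0 \<le> y\<close>
  proof (induction y rule: int_ge_induct)
    case base then show ?case using height_invD(1)[OF h, of 0] by simp
  next
    case (step i) then show ?case using height_invD(4)[OF h, of i] by simp
  qed
  show "v y \<le> int n + 1 - int p" using \<open>y \<le> int n + 1\<close>
  proof (induction y rule: int_le_induct)
    case base then show ?case using height_invD(2)[OF h, of "int n + 1"] by simp
  next
    case (step i) then show ?case using height_invD(5)[OF h, of i] by simp
  qed
qed

text \<open>Stability makes \<open>v\<close> concave on the sites. With increments 0 or 1 it rises
  with slope 1 and then stays flat, and the boundary values fix both pieces.\<close>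

lemma stable_height:
  assumes h: "height_inv n p f v" and st: "stable (cfg (n + 1) f)" and "0 \<le> y" "y \<le> int n + 1"
  shows "v y = min y (int n + 1 - int p)"
proof -
  have conc: "v (z + 1) - v z \<le> v z - v (z - 1)" if "0 \<le> z" "z \<le> int n + 1" for z
  proof -
    have "card (cfg (n + 1) f z) \<le> 1" using st by (simp add: stable_def)
    then show ?thesis using height_invD(7)[OF h, of z] that by auto
  qed
  consider "v y = v (y - 1) + 1" | "v y = v (y - 1)"
    using height_invD(5,6)[OF h, of y] by linarith
  then show ?thesis
  proof cases
    case 1
    have "v z = z + v y - y \<and> v (z - 1) = v z - 1" if "z \<le> y" "0 \<le> z" for z
      using that
    proof (induction z rule: int_le_induct)
      case base then show ?case using 1 by simp
    next
      case (step i)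
      then have "v i = i + v y - y \<and> v (i - 1) = v i - 1" by auto
      moreover have "v (i - 1) - v (i - 1 - 1) \<ge> v i - v (i - 1)"
        using conc[of "i - 1"] step \<open>y \<le> int n + 1\<close> by auto
      ultimately show ?case using height_invD(6)[OF h, of "i - 1"] by auto
    qed
    from this[of 0] have "v y = y" using \<open>0 \<le> y\<close> height_invD(1)[OF h, of 0] by auto
    then show ?thesis using height_le[OF h assms(3,4)] by auto
  next
    case 2
    have "z \<le> int n + 1 \<Longrightarrow> v z = v y \<and> v z = v (z - 1)" if "y \<le> z" for z
      using that
    proof (induction z rule: int_ge_induct)
      case base then show ?case using 2 by simp
    next
      case (step i)
      then have "v i = v y \<and> v i = v (i - 1)" by auto
      moreover have "v (i + 1) - v i \<le> v i - v (i - 1)"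
        using conc[of i] step \<open>0 \<le> y\<close> by auto
      ultimately show ?case using height_invD(3)[OF h, of i] by auto
    qed
    from this[of "int n + 1"] have "v y = int n + 1 - int p"
      using \<open>y \<le> int n + 1\<close> height_invD(2)[OF h, of "int n + 1"] by auto
    then show ?thesis using height_le[OF h assms(3,4)] by auto
  qed
qed

text \<open>The total deficit of the heights below \<open>n + 1 - p\<close> is nonnegative and drops
  with each toppling.\<close>

lemma reaches_stable:
  fixes f :: "nat \<Rightarrow> int" and v :: "int \<Rightarrow> int"
  assumes "height_inv n p f v"
  shows "\<exists>c. topple_step\<^sup>*\<^sup>* (cfg (n + 1) f) c \<and> stable c"
  using assms
proof (induction "nat (\<Sum>y\<in>{0..int n + 1}. int n + 1 - int p - v y)" arbitrary: f v
    rule: less_induct)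
  case (less v f)
  show ?case
  proof (cases "stable (cfg (n + 1) f)")
    case False
    then obtain x where x: "\<not> card (cfg (n + 1) f x) \<le> 1" unfolding stable_def by blast
    then have "\<exists>a b. a \<in> cfg (n + 1) f x \<and> b \<in> cfg (n + 1) f x \<and> a \<noteq> b"
      using card_le_Suc0_iff_eq[of "cfg (n + 1) f x"] by auto
    then obtain a b where "a \<in> cfg (n + 1) f x" "b \<in> cfg (n + 1) f x" "a < b"
      by (metis linorder_neqE_nat)
    then have ab: "a \<in> {1..n+1}" "b \<in> {1..n+1}" "a < b" "f a = f b" by (auto simp: cfg_def)
    let ?w = "v(f a := v (f a) + 1)"
    note h' = height_inv_fire[OF less.prems ab]
    have X: "0 < f a" "f a < int n + 1"
      using height_at_crowded_site[OF less.prems crowdedI[OF ab]] by auto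
    have "(\<Sum>y\<in>{0..int n + 1}. int n + 1 - int p - ?w y) <
        (\<Sum>y\<in>{0..int n + 1}. int n + 1 - int p - v y)"
      by (rule sum_strict_mono_ex1) (use X in auto)
    moreover have "0 \<le> (\<Sum>y\<in>{0..int n + 1}. int n + 1 - int p - ?w y)"
      by (rule sum_nonneg) (use height_le(2)[OF h'] in auto)
    ultimately have "\<exists>c. topple_step\<^sup>*\<^sup>* (cfg (n + 1) (fire f a b)) c \<and> stable c"
      by (intro less.hyps[OF _ h']) auto
    then show ?thesis
      using topple_step_cfgI[OF ab] by (meson converse_rtranclp_into_rtranclp)
  qed blast
qed

text \<open>
  A single chip may temporarily violate the bound \<open>v (f k) < k\<close>; bounding the number of chips
  with label at most \<open>k\<close> to the right of a site makes the condition stable under toppling.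
\<close>

definition right_bounded :: "nat \<Rightarrow> (nat \<Rightarrow> int) \<Rightarrow> (int \<Rightarrow> int) \<Rightarrow> bool" where
  "right_bounded n f v \<longleftrightarrow>
     (\<forall>k\<le>n + 1. \<forall>y. int (card {j \<in> {1..k}. y \<le> f j}) \<le> max 0 (int k - v y))"

text \<open>
  The mirror image of \<open>right_bounded\<close>: reversing sites and labels replaces the height \<open>v y\<close> by
  \<open>v y - y + p\<close>.
\<close>

definition left_bounded :: "nat \<Rightarrow> nat \<Rightarrow> (nat \<Rightarrow> int) \<Rightarrow> (int \<Rightarrow> int) \<Rightarrow> bool" where
  "left_bounded n p f v \<longleftrightarrow>
     (\<forall>k\<ge>1. \<forall>y. int (card {j \<in> {k..n + 1}. f j \<le> y}) \<le>
        max 0 (int n + 2 - int k - (v y - y + int p)))"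

text \<open>At the toppled site \<open>x\<close> the bound tightens by one. Only the counts at
  \<open>y = x\<close>, which \<open>a\<close> may leave, and at \<open>y = x + 1\<close>, which
  \<open>b\<close> may enter, can change.\<close>

lemma right_bounded_fire:
  assumes h: "height_inv n p f v" and Q: "right_bounded n f v"
    and ab: "a \<in> {1..n+1}" "b \<in> {1..n+1}" "a < b" "f a = f b"
  shows "right_bounded n (fire f a b) (v(f a := v (f a) + 1))"
  unfolding right_bounded_def
proof (intro allI impI)
  note v = height_at_crowded_site(2)[OF h crowdedI[OF ab]]
  note only_ab = crowded_site_eq[OF h ab]
  fix k y assume k: "k \<le> n + 1"
  let ?N = "\<lambda>f y. {j \<in> {1..k}. y \<le> f j}" and ?x = "f a"
  have Q: "int (card (?N f y)) \<le> max 0 (int k - v y)" for y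
    using Q k unfolding right_bounded_def by blast
  consider "y = ?x" "a \<le> k" | "y = ?x" "\<not> a \<le> k" | "y = ?x + 1" "b \<le> k"
    | "y = ?x + 1" "\<not> b \<le> k" | "y \<noteq> ?x" "y \<noteq> ?x + 1" by blast
  then show "int (card (?N (fire f a b) y)) \<le> max 0 (int k - (v(?x := v ?x + 1)) y)"
  proof cases
    case 1
    then have "?N (fire f a b) y = ?N f y - {a}" using ab by auto
    moreover have "a \<in> ?N f y" using 1 ab by auto
    ultimately have "int (card (?N (fire f a b) y)) = int (card (?N f y)) - 1"
      using card_Suc_Diff1[of "?N f y" a] by simp
    then show ?thesis using Q[of y] 1 by auto
  next
    case 2
    \<comment> \<open>Both chips at the site exceed \<open>k\<close>, so its count is that of the
      next site, whose bound already uses the height \<open>v ?x + 1\<close>.\<close>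
    then have "j \<in> {1..k} \<Longrightarrow> f j \<noteq> ?x" for j using only_ab[of j] k ab by auto
    then have "?N (fire f a b) y = ?N f (?x + 1)" using 2 ab by force
    then show ?thesis using Q[of "?x + 1"] 2 v by simp
  next
    case 3
    \<comment> \<open>Before the toppling \<open>a\<close> and \<open>b\<close> both count at
      \<open>?x\<close>. So the bound there is at least 2 and can spare the one lost in passing to
      \<open>?x + 1\<close>.\<close>
    then have "?N (fire f a b) y \<subseteq> ?N f ?x - {a}" using ab by auto
    then have "card (?N (fire f a b) y) \<le> card (?N f ?x - {a})" by (intro card_mono) auto
    moreover have "{a, b} \<subseteq> ?N f ?x" using 3 ab by auto
    moreover from this have "card {a, b} \<le> card (?N f ?x)" by (intro card_mono) auto
    ultimately show ?thesis using Q[of ?x] 3 v ab by auto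
  next
    case 4
    then have "?N (fire f a b) y = ?N f y" using ab by auto
    then show ?thesis using Q[of y] 4 by simp
  next
    case 5
    then have "?N (fire f a b) y = ?N f y" using ab by auto
    then show ?thesis using Q[of y] 5 by simp
  qed
qed

text \<open>The mirrored argument: \<open>b\<close> takes the role of \<open>a\<close>, and the left
  neighbour is used, where \<open>v (x - 1) = v x\<close> makes \<open>v y - y + p\<close> one
  larger.\<close>

lemma left_bounded_fire:
  assumes h: "height_inv n p f v" and Q: "left_bounded n p f v"
    and ab: "a \<in> {1..n+1}" "b \<in> {1..n+1}" "a < b" "f a = f b"
  shows "left_bounded n p (fire f a b) (v(f a := v (f a) + 1))"
  unfolding left_bounded_def
proof (intro allI impI)
  note v = height_at_crowded_site(1)[OF h crowdedI[OF ab]]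
  note only_ab = crowded_site_eq[OF h ab]
  fix k y assume k: "1 \<le> (k::nat)"
  let ?N = "\<lambda>f y. {j \<in> {k..n + 1}. f j \<le> y}" and ?x = "f a"
  have Q: "int (card (?N f y)) \<le> max 0 (int n + 2 - int k - (v y - y + int p))" for y
    using Q k unfolding left_bounded_def by blast
  consider "y = ?x" "k \<le> b" | "y = ?x" "\<not> k \<le> b" | "y = ?x - 1" "k \<le> a"
    | "y = ?x - 1" "\<not> k \<le> a" | "y \<noteq> ?x" "y \<noteq> ?x - 1" by blast
  then show "int (card (?N (fire f a b) y)) \<le>
      max 0 (int n + 2 - int k - ((v(?x := v ?x + 1)) y - y + int p))"
  proof cases
    case 1
    then have "?N (fire f a b) y = ?N f y - {b}" using ab by auto
    moreover have "b \<in> ?N f y" using 1 ab by auto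
    ultimately have "int (card (?N (fire f a b) y)) = int (card (?N f y)) - 1"
      using card_Suc_Diff1[of "?N f y" b] by simp
    then show ?thesis using Q[of y] 1 by auto
  next
    case 2
    then have "j \<in> {k..n+1} \<Longrightarrow> f j \<noteq> ?x" for j using only_ab[of j] k ab by auto
    then have "?N (fire f a b) y = ?N f (?x - 1)" using 2 ab by force
    then show ?thesis using Q[of "?x - 1"] 2 v by simp
  next
    case 3
    then have "?N (fire f a b) y \<subseteq> ?N f ?x - {b}" using ab by auto
    then have "card (?N (fire f a b) y) \<le> card (?N f ?x - {b})" by (intro card_mono) auto
    moreover have "{a, b} \<subseteq> ?N f ?x" using 3 ab by auto
    moreover from this have "card {a, b} \<le> card (?N f ?x)" by (intro card_mono) auto
    ultimately show ?thesis using Q[of ?x] 3 v ab by auto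
  next
    case 4
    then have "?N (fire f a b) y = ?N f y" using ab by auto
    then show ?thesis using Q[of y] 4 by simp
  next
    case 5
    then have "?N (fire f a b) y = ?N f y" using ab by auto
    then show ?thesis using Q[of y] 5 by simp
  qed
qed

section \<open>Reading the final configuration\<close>

lemma stable_inj:
  assumes "stable (cfg N f)"
  shows "inj_on f {1..N}"
proof (rule linorder_inj_onI')
  fix a b assume "a \<in> {1..N}" "b \<in> {1..N}" "a < b"
  then show "f a \<noteq> f b"
    using crowdedI[of a N b f] assms unfolding stable_def
    by (metis Suc_1 not_less_eq_eq One_nat_def)
qed

text \<open>The continued height is affine up to \<open>0\<close> and from \<open>n + 1\<close> on,
  so the count formula gives zero beyond these sites.\<close>

lemma site_in_range:
  assumes h: "height_inv n p f v" and "p \<le> n + 1" and k: "k \<in> {1..n+1}"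
  shows "0 \<le> f k" "f k \<le> int n + 1"
proof -
  have "k \<in> cfg (n + 1) f (f k)" using k by (simp add: cfg_def)
  then have "card (cfg (n + 1) f (f k)) \<noteq> 0" by auto
  then show "0 \<le> f k" "f k \<le> int n + 1"
    using height_invD(7)[OF h, of "f k"] height_invD(1)[OF h, of "f k"]
      height_invD(1)[OF h, of "f k - 1"] height_invD(1)[OF h, of "f k + 1"]
      height_invD(2)[OF h, of "f k"] height_invD(2)[OF h, of "f k - 1"]
      height_invD(2)[OF h, of "f k + 1"]
    by (auto split: if_splits)
qed

text \<open>The final height \<open>min y (n + 1 - p)\<close> bends only at
  \<open>n + 1 - p\<close>, which is therefore the only empty site.\<close>

lemma stable_occupied:
  assumes h: "height_inv n p f v" and st: "stable (cfg (n + 1) f)" and p: "p \<le> n + 1"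
    and y: "0 \<le> y" "y \<le> int n + 1" "y \<noteq> int n + 1 - int p"
  obtains j where "j \<in> {1..n+1}" "f j = y"
proof -
  have v: "v z = min z (int n + 1 - int p)" for z
    using stable_height[OF h st, of z] height_invD(1,2)[OF h, of z] p
    by (cases "0 \<le> z"; cases "z \<le> int n + 1") auto
  have "card (cfg (n + 1) f y) = 1"
    using height_invD(7)[OF h, of y] y by (auto simp: v min_def split: if_splits)
  then obtain j where "j \<in> cfg (n + 1) f y" by fastforce
  then show thesis using that by (auto simp: cfg_def)
qed

lemma reads_identity_cfgD:
  "reads_identity (cfg N f) \<Longrightarrow> a \<in> {1..N} \<Longrightarrow> b \<in> {1..N} \<Longrightarrow> a < b \<Longrightarrow> f a < f b"
  unfolding reads_identity_def cfg_def by blast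

text \<open>The negated inequality \<open>k \<le> v (f k)\<close> persists: a left move from
  \<open>x\<close> uses \<open>v (x - 1) = v x\<close>, a right move gains height, and the site of a
  resting chip never loses height.\<close>

lemma topples_to_identity_imp_right:
  assumes top: "topples_to_identity (cfg (n + 1) f)" and h: "height_inv n p f v"
    and p: "p \<le> n + 1" and k: "k \<in> {1..n+1}"
  shows "v (f k) < int k"
proof (rule ccontr)
  assume "\<not> ?thesis"
  then have Q: "int k \<le> v (f k)" by simp
  obtain c where c: "topple_step\<^sup>*\<^sup>* (cfg (n + 1) f) c" "stable c" "reads_identity c"
    using top unfolding topples_to_identity_def by blast
  have "\<exists>g w. c = cfg (n + 1) g \<and> height_inv n p g w \<and> int k \<le> w (g k)"
    by (rule reachable_invariant[OF c(1) h, where Q = "\<lambda>g w. int k \<le> w (g k)", OF Q]) auto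
  then obtain g w where g: "c = cfg (n + 1) g" and hg: "height_inv n p g w" and "int k \<le> w (g k)"
    by blast
  moreover have st: "stable (cfg (n + 1) g)" using c g by simp
  ultimately have *: "int k \<le> g k" "int k \<le> int n + 1 - int p"
    using stable_height[OF hg st site_in_range[OF hg p k]] by auto
  \<comment> \<open>These \<open>k\<close> sites lie left of the empty site, so all are occupied,
    but sortedness leaves only the \<open>k - 1\<close> smaller labels for them.\<close>
  have "{0..<int k} \<subseteq> g ` {1..<k}"
  proof
    fix y assume y: "y \<in> {0..<int k}"
    then obtain j where j: "j \<in> {1..n+1}" "g j = y"
      using stable_occupied[OF hg st p, of y] * k by auto
    have "g k < g j" if "k < j"
      using reads_identity_cfgD[of "n + 1" g] c(3) that j k unfolding g by blast
    then have "j < k" using j y * by (cases j k rule: linorder_cases) auto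
    then show "y \<in> g ` {1..<k}" using j by auto
  qed
  then have "card {0..<int k} \<le> card (g ` {1..<k})" by (intro card_mono) auto
  also have "\<dots> \<le> card {1..<k}" by (rule card_image_le) simp
  finally show False using k by auto
qed

text \<open>The same pigeonhole argument for the mirrored height \<open>v y - y + p\<close>: the
  \<open>n + 2 - k\<close> sites from \<open>k\<close> on would be filled by the
  \<open>n + 1 - k\<close> larger labels.\<close>

lemma topples_to_identity_imp_left:
  assumes top: "topples_to_identity (cfg (n + 1) f)" and h: "height_inv n p f v"
    and p: "p \<le> n + 1" and k: "k \<in> {1..n+1}"
  shows "v (f k) - f k + int p < int n + 2 - int k"
proof (rule ccontr)
  assume "\<not> ?thesis"
  then have Q: "int n + 2 - int k \<le> v (f k) - f k + int p" by simp
  obtain c where c: "topple_step\<^sup>*\<^sup>* (cfg (n + 1) f) c" "stable c" "reads_identity c"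
    using top unfolding topples_to_identity_def by blast
  have "\<exists>g w. c = cfg (n + 1) g \<and> height_inv n p g w \<and> int n + 2 - int k \<le> w (g k) - g k + int p"
    by (rule reachable_invariant[OF c(1) h,
          where Q = "\<lambda>g w. int n + 2 - int k \<le> w (g k) - g k + int p", OF Q]) auto
  then obtain g w where g: "c = cfg (n + 1) g" and hg: "height_inv n p g w"
    and "int n + 2 - int k \<le> w (g k) - g k + int p"
    by blast
  moreover have st: "stable (cfg (n + 1) g)" using c g by simp
  ultimately have *: "g k < int k" "int n + 1 - int p < int k"
    using stable_height[OF hg st site_in_range[OF hg p k]] by auto
  have "{int k..int n + 1} \<subseteq> g ` {k<..n+1}"
  proof
    fix y assume y: "y \<in> {int k..int n + 1}"
    then obtain j where j: "j \<in> {1..n+1}" "g j = y"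
      using stable_occupied[OF hg st p, of y] * k by auto
    have "g j < g k" if "j < k"
      using reads_identity_cfgD[of "n + 1" g] c(3) that j k unfolding g by blast
    then have "k < j" using j y * by (cases j k rule: linorder_cases) auto
    then show "y \<in> g ` {k<..n+1}" using j by auto
  qed
  then have "card {int k..int n + 1} \<le> card (g ` {k<..n+1})" by (intro card_mono) auto
  also have "\<dots> \<le> card {k<..n+1}" by (rule card_image_le) simp
  finally show False using k by auto
qed

lemma inj_below_diagonal:
  fixes g :: "nat \<Rightarrow> int"
  assumes "inj_on g {1..m}" "\<And>k. k \<in> {1..m} \<Longrightarrow> 0 \<le> g k \<and> g k < int k" "k \<in> {1..m}"
  shows "g k = int k - 1"
  using assms(3)
proof (induction k rule: less_induct)
  case (less k)
  have "\<not> g k < int k - 1"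
  proof
    assume "g k < int k - 1"
    \<comment> \<open>By induction label \<open>j\<close> already occupies the site
      \<open>g k\<close>.\<close>
    define j where "j = nat (g k + 1)"
    have j: "j \<in> {1..m}" "j < k" "int j - 1 = g k"
      using \<open>g k < int k - 1\<close> assms(2)[OF less.prems] less.prems by (auto simp: j_def)
    then have "g j = g k" using less.IH by simp
    then show False using inj_onD[OF assms(1), of j k] j less.prems by auto
  qed
  then show ?case using assms(2)[OF less.prems] by auto
qed

text \<open>At the end both counting bounds vanish at suitable cutoffs: labels up to
  \<open>n + 1 - p\<close> lie below their own number, the others at or above it. Injectivity then
  leaves only the sorted arrangement.\<close>

lemma topples_to_identityI:
  assumes h: "height_inv n p f v" and p: "p \<le> n + 1"
    and R: "right_bounded n f v" and L: "left_bounded n p f v"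
  shows "topples_to_identity (cfg (n + 1) f)"
proof -
  obtain c where c: "topple_step\<^sup>*\<^sup>* (cfg (n + 1) f) c" "stable c"
    using reaches_stable[OF h] by blast
  have "\<exists>g w. c = cfg (n + 1) g \<and> height_inv n p g w \<and> right_bounded n g w \<and> left_bounded n p g w"
    by (rule reachable_invariant[OF c(1) h, where
          Q = "\<lambda>g w. right_bounded n g w \<and> left_bounded n p g w"])
      (use R L right_bounded_fire left_bounded_fire in blast)+
  then obtain g w where g: "c = cfg (n + 1) g" and hg: "height_inv n p g w"
    and R: "right_bounded n g w" and L: "left_bounded n p g w" by blast
  have st: "stable (cfg (n + 1) g)" using c g by simp
  note inj = stable_inj[OF st]
  define m where "m = n + 1 - p"
  have m: "int m = int n + 1 - int p" "m \<le> n + 1" using p by (auto simp: m_def)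
  have low: "g k < int k" if "k \<in> {1..m}" for k
  proof (rule ccontr)
    assume "\<not> ?thesis"
    then have "k \<in> {j \<in> {1..k}. int k \<le> g j}" using that by auto
    then have "card {j \<in> {1..k}. int k \<le> g j} \<noteq> 0" by auto
    moreover have "int (card {j \<in> {1..k}. int k \<le> g j}) \<le> max 0 (int k - w (int k))"
      using R that m unfolding right_bounded_def by auto
    ultimately show False using stable_height[OF hg st, of "int k"] that m by auto
  qed
  have high: "int k \<le> g k" if "k \<in> {m<..n+1}" for k
  proof (rule ccontr)
    assume "\<not> ?thesis"
    then have "k \<in> {j \<in> {k..n+1}. g j \<le> int k - 1}" using that by auto
    then have "card {j \<in> {k..n+1}. g j \<le> int k - 1} \<noteq> 0" by auto
    moreover have "int (card {j \<in> {k..n+1}. g j \<le> int k - 1}) \<le>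
        max 0 (int n + 2 - int k - (w (int k - 1) - (int k - 1) + int p))"
      using L[unfolded left_bounded_def, rule_format, of k "int k - 1"] that by simp
    ultimately show False using stable_height[OF hg st, of "int k - 1"] that m by auto
  qed
  have low_eq: "g k = int k - 1" if "k \<in> {1..m}" for k
    by (rule inj_below_diagonal[OF inj_on_subset[OF inj] _ that])
      (use m low site_in_range[OF hg p] in auto)
  \<comment> \<open>Reversing labels (\<open>k\<close> to \<open>n + 2 - k\<close>) and sites
    (\<open>s\<close> to \<open>n + 1 - s\<close>) brings the labels above \<open>m\<close> into the
    situation of \<open>inj_below_diagonal\<close>.\<close>
  have reflected_eq: "int n + 1 - g (n + 2 - k) = int k - 1" if "k \<in> {1..n + 1 - m}" for k
  proof (rule inj_below_diagonal[OF _ _ that])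
    show "inj_on (\<lambda>k. int n + 1 - g (n + 2 - k)) {1..n + 1 - m}"
    proof (rule inj_onI)
      fix i j assume ij: "i \<in> {1..n + 1 - m}" "j \<in> {1..n + 1 - m}"
        "int n + 1 - g (n + 2 - i) = int n + 1 - g (n + 2 - j)"
      then have "n + 2 - i = n + 2 - j" by (intro inj_onD[OF inj]) auto
      then show "i = j" using ij by auto
    qed
    show "0 \<le> int n + 1 - g (n + 2 - k) \<and> int n + 1 - g (n + 2 - k) < int k"
      if "k \<in> {1..n + 1 - m}" for k
    proof -
      have "n + 2 - k \<in> {m<..n+1}" using that by auto
      then show ?thesis using high[of "n + 2 - k"] site_in_range[OF hg p, of "n + 2 - k"] that
        by auto
    qed
  qed
  have high_eq: "g k = int k" if "k \<in> {m<..n+1}" for k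
  proof -
    have "n + 2 - k \<in> {1..n + 1 - m}" using that by auto
    then show ?thesis using reflected_eq[of "n + 2 - k"] that by auto
  qed
  have "g a < g b" if "a \<in> {1..n+1}" "b \<in> {1..n+1}" "a < b" for a b
    using low_eq[of a] low_eq[of b] high_eq[of a] high_eq[of b] that
    by (cases "a \<le> m"; cases "b \<le> m") auto
  then have "reads_identity c" unfolding g reads_identity_def cfg_def by auto
  with c show ?thesis unfolding topples_to_identity_def by blast
qed

section \<open>The initial configuration and the bounds on positions\<close>

definition chip_site :: "(nat \<Rightarrow> nat) \<Rightarrow> nat \<Rightarrow> nat \<Rightarrow> nat \<Rightarrow> int" where
  "chip_site \<pi> r p k = (if k = r then int p else int (inv \<pi> (if k < r then k else k - 1)))"

lemma init_config_eq_cfg: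
  assumes perm: "\<pi> permutes {1..n}" and r: "r \<in> {1..n+1}"
  shows "init_config n \<pi> r p = cfg (n + 1) (chip_site \<pi> r p)"
proof (intro ext set_eqI)
  fix s k
  have inv: "(1 \<le> s \<and> s \<le> int n \<and> \<pi> (nat s) = i) \<longleftrightarrow> int (inv \<pi> i) = s" if "i \<in> {1..n}" for i
  proof
    assume "int (inv \<pi> i) = s"
    moreover have "inv \<pi> i \<in> {1..n}" using that permutes_in_image[OF permutes_inv[OF perm]] by blast
    ultimately show "1 \<le> s \<and> s \<le> int n \<and> \<pi> (nat s) = i"
      using permutes_inverses(1)[OF perm] by auto
  qed (use permutes_inverses(2)[OF perm] in auto)
  have rng: "\<pi> (nat s) \<in> {1..n}" if "1 \<le> s" "s \<le> int n"
  proof -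
    have "nat s \<in> {1..n}" using that by auto
    then show ?thesis using permutes_in_image[OF perm] by blast
  qed
  consider "k = r" | "k < r" "k = 0" | "k < r" "k \<in> {1..n}" | "k > r" "k - 1 \<in> {1..n}"
    | "k > r" "k > n + 1"
    using r by fastforce
  then show "k \<in> init_config n \<pi> r p s \<longleftrightarrow> k \<in> cfg (n + 1) (chip_site \<pi> r p) s"
  proof cases
    case 1
    then show ?thesis using r by (auto simp: init_config_def cfg_def chip_site_def split: if_splits)
  next
    case 2
    then show ?thesis using r rng
      by (auto simp: init_config_def cfg_def split: if_splits)
  next
    case 3
    then show ?thesis using r inv[of k]
      by (auto simp: init_config_def cfg_def chip_site_def split: if_splits)
  next
    case 4
    then show ?thesis using r inv[of "k - 1"]
      by (auto simp: init_config_def cfg_def chip_site_def split: if_splits)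
  next
    case 5
    then show ?thesis using r rng
      by (fastforce simp: init_config_def cfg_def split: if_splits)
  qed
qed

text \<open>The slopes 1, 0, 1, 0 change at \<open>0\<close>, \<open>p\<close> and
  \<open>n + 1\<close>: the two drops empty the end sites, and the rise puts a second chip on
  \<open>p\<close>.\<close>

definition initial_height :: "nat \<Rightarrow> nat \<Rightarrow> int \<Rightarrow> int" where
  "initial_height n p y = (if y \<le> 0 then y else max 0 (min y (int n + 1) - int p))"

lemma height_inv_initial:
  assumes perm: "\<pi> permutes {1..n}" and r: "r \<in> {1..n+1}" and p: "1 \<le> p" "p \<le> n"
  shows "height_inv n p (chip_site \<pi> r p) (initial_height n p)"
proof -
  have "int (card (init_config n \<pi> r p y)) = (if 1 \<le> y \<and> y \<le> int n then 1 else 0)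
      + (if y = int p then 1 else 0)" for y
    using p by (auto simp: init_config_def card_insert_if)
  then show ?thesis
    using p unfolding height_inv_def init_config_eq_cfg[OF perm r, symmetric]
    by (auto simp: initial_height_def max_def)
qed

text \<open>A label \<open>j\<close> at a site \<open>\<ge> y\<close> satisfies
  \<open>j \<ge> y - p + 1\<close>, leaving at most \<open>max 0 (k - (y - p))\<close> labels up to
  \<open>k\<close>.\<close>

lemma right_bounded_initial:
  assumes "\<And>k. k \<in> {1..n+1} \<Longrightarrow> f k \<le> int p + int k - 1"
  shows "right_bounded n f (initial_height n p)"
  unfolding right_bounded_def
proof (intro allI impI)
  fix k y assume "k \<le> n + 1"
  have sub: "{j \<in> {1..k}. y \<le> f j} \<subseteq> {max 1 (nat (y - int p + 1))..k}"
  proof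
    fix j assume j: "j \<in> {j \<in> {1..k}. y \<le> f j}"
    then have "y \<le> int p + int j - 1" using assms[of j] \<open>k \<le> n + 1\<close> by auto
    then show "j \<in> {max 1 (nat (y - int p + 1))..k}" using j by auto
  qed
  then have "card {j \<in> {1..k}. y \<le> f j} \<le> card {max 1 (nat (y - int p + 1))..k}"
    by (intro card_mono) auto
  then show "int (card {j \<in> {1..k}. y \<le> f j}) \<le> max 0 (int k - initial_height n p y)"
    by (auto simp: initial_height_def min_def max_def split: if_splits)
qed

lemma left_bounded_initial:
  assumes "\<And>k. k \<in> {1..n+1} \<Longrightarrow> int p + int k - int n - 1 \<le> f k" and p: "p \<le> n + 1"
  shows "left_bounded n p f (initial_height n p)"
  unfolding left_bounded_def
proof (intro allI impI)
  fix k y assume "1 \<le> (k::nat)"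
  have sub: "{j \<in> {k..n+1}. f j \<le> y} \<subseteq> {k..<nat (min (int n + 2) (y + int n + 2 - int p))}"
  proof
    fix j assume j: "j \<in> {j \<in> {k..n+1}. f j \<le> y}"
    then have "int p + int j - int n - 1 \<le> y" using assms(1)[of j] \<open>1 \<le> k\<close> by auto
    then show "j \<in> {k..<nat (min (int n + 2) (y + int n + 2 - int p))}" using j by auto
  qed
  then have "card {j \<in> {k..n+1}. f j \<le> y} \<le>
      card {k..<nat (min (int n + 2) (y + int n + 2 - int p))}"
    by (intro card_mono) auto
  then show "int (card {j \<in> {k..n+1}. f j \<le> y}) \<le>
      max 0 (int n + 2 - int k - (initial_height n p y - y + int p))"
    using p by (auto simp: initial_height_def min_def max_def split: if_splits)
qed

lemma in_all_T_sets_iff: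
  assumes perm: "\<pi> permutes {1..n}" and p: "1 \<le> p" "p \<le> n"
  shows "\<pi> \<in> (\<Inter>r\<in>{1..n+1}. T_set n r p) \<longleftrightarrow>
    (\<forall>i\<in>{1..n}. int p + int i - int n \<le> int (inv \<pi> i) \<and> int (inv \<pi> i) \<le> int p + int i - 1)"
    (is "?l \<longleftrightarrow> ?r")
proof
  assume l: ?l
  have top: "topples_to_identity (cfg (n + 1) (chip_site \<pi> r p))" if "r \<in> {1..n+1}" for r
    using l that init_config_eq_cfg[OF perm that, of p] by (force simp: T_set_def)
  show ?r
  proof
    fix i assume i: "i \<in> {1..n}"
    have rng: "inv \<pi> i \<in> {1..n}" using i permutes_in_image[OF permutes_inv[OF perm]] by blast
    \<comment> \<open>With \<open>r = n + 1\<close> no label is shifted, and the inequality is the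
      upper bound on the position of \<open>i\<close>.\<close>
    have "initial_height n p (chip_site \<pi> (n + 1) p i) < int i"
      using i p top
      by (intro topples_to_identity_imp_right[OF _ height_inv_initial[OF perm]]) auto
    \<comment> \<open>With \<open>r = 1\<close> entry \<open>i\<close> carries label
      \<open>i + 1\<close>, and the mirrored inequality is the lower bound.\<close>
    moreover have "initial_height n p (chip_site \<pi> 1 p (i + 1)) - chip_site \<pi> 1 p (i + 1) + int p
        < int n + 2 - int (i + 1)"
      using i p top
      by (intro topples_to_identity_imp_left[OF _ height_inv_initial[OF perm]]) auto
    ultimately show "int p + int i - int n \<le> int (inv \<pi> i) \<and> int (inv \<pi> i) \<le> int p + int i - 1"
      using i rng by (auto simp: chip_site_def initial_height_def split: if_splits)
  qed
next
  assume r: ?r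
  have "topples_to_identity (cfg (n + 1) (chip_site \<pi> r p))" if "r \<in> {1..n+1}" for r
  proof (rule topples_to_identityI[OF height_inv_initial[OF perm that p]])
    \<comment> \<open>Unshifted labels have one unit of slack in the lower bound, shifted labels in
      the upper one; chip \<open>r\<close> sits at \<open>p\<close>, which is always
      admissible.\<close>
    have *: "int p + int k - int n - 1 \<le> chip_site \<pi> r p k \<and> chip_site \<pi> r p k \<le> int p + int k - 1"
      if k: "k \<in> {1..n+1}" for k
    proof -
      consider "k = r" | "k < r" "k \<in> {1..n}" | "r < k" "k - 1 \<in> {1..n}"
        using k \<open>r \<in> {1..n+1}\<close> by fastforce
      then show ?thesis
        using r[rule_format, of k] r[rule_format, of "k - 1"] k p
        by cases (auto simp: chip_site_def)
    qed
    show "right_bounded n (chip_site \<pi> r p) (initial_height n p)"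
      using * by (intro right_bounded_initial) blast
    show "left_bounded n p (chip_site \<pi> r p) (initial_height n p)"
      using * p by (intro left_bounded_initial) auto
  qed (use p in simp)
  then show ?l using init_config_eq_cfg[OF perm] perm by (auto simp: T_set_def)
qed

section \<open>Rook placements\<close>

text \<open>Placements of non-attacking rooks: \<open>card (rooks B t)\<close> is the
  \<open>t\<close>-th rook number of the board \<open>B\<close>.\<close>

definition rooks :: "('a \<times> 'b) set \<Rightarrow> nat \<Rightarrow> ('a \<times> 'b) set set" where
  "rooks B t = {M. M \<subseteq> B \<and> inj_on fst M \<and> inj_on snd M \<and> card M = t}"

lemma finite_rooks: "finite B \<Longrightarrow> finite (rooks B t)"
  unfolding rooks_def by (rule finite_subset[of _ "Pow B"]) auto

lemma rooks_0: "finite B \<Longrightarrow> rooks B 0 = {{}}"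
  unfolding rooks_def by (auto dest: finite_subset)

lemma rooks_eq_empty:
  assumes "finite B" "card (fst ` B) < t"
  shows "rooks B t = {}"
proof -
  have False if "M \<subseteq> B" "inj_on fst M" "card M = t" for M
    using card_mono[of "fst ` B" "fst ` M"] card_image[OF that(2)] assms that by auto
  then show ?thesis unfolding rooks_def by blast
qed

text \<open>Split by whether row \<open>x\<close> holds a rook. If so, removing it leaves
  \<open>t\<close> rooks in \<open>B\<close>, which block exactly \<open>t\<close> columns of
  \<open>Y\<close>.\<close>

lemma card_rooks_add_row:
  assumes B: "finite B" and Y: "finite Y" and x: "x \<notin> fst ` B" and BY: "snd ` B \<subseteq> Y"
  shows "card (rooks (B \<union> {x} \<times> Y) (Suc t)) =
    card (rooks B (Suc t)) + card (rooks B t) * (card Y - t)"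
proof -
  let ?S = "SIGMA M:rooks B t. Y - snd ` M"
  let ?g = "\<lambda>(M, y). insert (x, y) M"
  have x': "(x, y) \<notin> B" for y using x by force
  have "rooks (B \<union> {x} \<times> Y) (Suc t) = rooks B (Suc t) \<union> ?g ` ?S" (is "?l = ?r")
  proof (intro equalityI subsetI)
    fix M assume M: "M \<in> ?l"
    show "M \<in> ?r"
    proof (cases "M \<subseteq> B")
      case True then show ?thesis using M by (auto simp: rooks_def)
    next
      case False
      then obtain y where y: "(x, y) \<in> M" "y \<in> Y" using M by (auto simp: rooks_def)
      have fin: "finite M" using M by (auto simp: rooks_def card_gt_0_iff intro: card_ge_0_finite)
      have inj: "inj_on fst M" "inj_on snd M" using M by (auto simp: rooks_def)
      have "M - {(x, y)} \<subseteq> B"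
      proof
        fix z assume z: "z \<in> M - {(x, y)}"
        then have "fst z \<noteq> fst (x, y)" using inj_onD[OF inj(1), of z "(x, y)"] y by blast
        then show "z \<in> B" using z M by (auto simp: rooks_def)
      qed
      moreover have "card (M - {(x, y)}) = t" using M y fin by (simp add: rooks_def)
      ultimately have "M - {(x, y)} \<in> rooks B t"
        using inj by (auto simp: rooks_def intro: inj_on_subset)
      moreover have "y \<notin> snd ` (M - {(x, y)})"
        using inj_onD[OF inj(2), of _ "(x, y)"] y by fastforce
      moreover have "M = ?g (M - {(x, y)}, y)" using y by auto
      ultimately show ?thesis using y by blast
    qed
  next
    fix M assume "M \<in> ?r"
    then show "M \<in> ?l"
    proof
      assume "M \<in> rooks B (Suc t)" then show ?thesis by (auto simp: rooks_def)
    next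
      assume "M \<in> ?g ` ?S"
      then obtain M' y where M': "M' \<in> rooks B t" "y \<in> Y" "y \<notin> snd ` M'" "M = insert (x, y) M'"
        by auto
      then have "finite M'" using B by (auto simp: rooks_def intro: finite_subset)
      moreover have "x \<notin> fst ` M'" "(x, y) \<notin> M'" using M' x x' by (auto simp: rooks_def)
      ultimately show ?thesis using M' by (auto simp: rooks_def)
    qed
  qed
  moreover have "rooks B (Suc t) \<inter> ?g ` ?S = {}"
    using x' by (auto simp: rooks_def)
  moreover have "inj_on ?g ?S"
  proof (rule inj_onI, clarify)
    fix M y M' y'
    assume *: "M \<in> rooks B t" "M' \<in> rooks B t" "insert (x, y) M = insert (x, y') M'"
    then have sub: "M \<subseteq> B" "M' \<subseteq> B" by (auto simp: rooks_def)
    have "(x, y) \<in> insert (x, y') M'" using * by blast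
    then have "y = y'" using x' sub by blast
    moreover have "M = insert (x, y) M \<inter> B" "M' = insert (x, y') M' \<inter> B" using sub x' by auto
    then have "M = M'" using *(3) by simp
    ultimately show "M = M' \<and> y = y'" by simp
  qed
  moreover have "card ?S = card (rooks B t) * (card Y - t)"
  proof -
    have "card (Y - snd ` M) = card Y - t" if "M \<in> rooks B t" for M
    proof -
      have "snd ` M \<subseteq> Y" "card (snd ` M) = t"
        using that BY by (auto simp: rooks_def card_image)
      then show ?thesis using Y by (simp add: card_Diff_subset finite_subset)
    qed
    then show ?thesis using finite_rooks[OF B] Y by (subst card_SigmaI) auto
  qed
  ultimately show ?thesis
    using finite_rooks[OF B] Y
    by (simp add: card_Un_disjoint card_image)
qed

text \<open>Rows are added one at a time; the factor on the left avoids a quotient of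
  factorials.\<close>

lemma card_rooks_rectangle:
  assumes "finite X" "finite Y" "card X \<le> card Y"
  shows "card (rooks (X \<times> Y) (card X)) * fact (card Y - card X) = (fact (card Y) :: nat)"
  using assms
proof (induction X rule: finite_induct)
  case empty then show ?case by (simp add: rooks_0)
next
  case (insert x X)
  have "card (fst ` (X \<times> Y)) \<le> card X" using insert by (intro card_mono) auto
  then have "rooks (X \<times> Y) (Suc (card X)) = {}"
    using insert by (intro rooks_eq_empty) auto
  moreover have "insert x X \<times> Y = X \<times> Y \<union> {x} \<times> Y" by auto
  ultimately have "card (rooks (insert x X \<times> Y) (Suc (card X))) =
      card (rooks (X \<times> Y) (card X)) * (card Y - card X)"
    using card_rooks_add_row[of "X \<times> Y" Y x "card X"] insert by auto
  moreover have "(card Y - card X) * fact (card Y - Suc (card X)) = (fact (card Y - card X) :: nat)"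
    using insert by (subst fact_reduce[of "card Y - card X"]) auto
  ultimately show ?case using insert by (simp add: mult.assoc)
qed

corollary card_rooks_square:
  assumes "finite X" "finite Y" "card X = t" "card Y = t"
  shows "card (rooks (X \<times> Y) t) = fact t"
  using card_rooks_rectangle[of X Y] assms by simp

section \<open>Staircase boards and Stirling numbers\<close>

definition staircase :: "nat \<Rightarrow> (nat \<times> nat) set" where
  "staircase N = {(i, j). j < i \<and> i < N}"

lemma finite_staircase: "finite (staircase N)"
  by (rule finite_subset[of _ "{..<N} \<times> {..<N}"]) (auto simp: staircase_def)

text \<open>Adding the full row of length \<open>N\<close> gives the Stirling recurrence
  \<open>S(N + 1, k) = k S(N, k) + S(N, k - 1)\<close>, with \<open>k = N + 1 - t\<close>.\<close>

lemma card_rooks_staircase: "t \<le> N \<Longrightarrow> card (rooks (staircase N) t) = Stirling N (N - t)"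
proof (induction N arbitrary: t)
  case 0
  then show ?case by (simp add: rooks_0 finite_staircase)
next
  case (Suc N)
  have eq: "staircase (Suc N) = staircase N \<union> {N} \<times> {..<N}" by (auto simp: staircase_def)
  show ?case
  proof (cases t)
    case 0
    then show ?thesis by (simp add: rooks_0 finite_staircase)
  next
    case (Suc t')
    have rec: "card (rooks (staircase (Suc N)) t) =
        card (rooks (staircase N) (Suc t')) + card (rooks (staircase N) t') * (N - t')"
      unfolding eq Suc
      by (subst card_rooks_add_row) (auto simp: finite_staircase, auto simp: staircase_def)
    show ?thesis
    proof (cases "t' = N")
      case True
      \<comment> \<open>The induction hypothesis does not cover \<open>N + 1\<close> rooks; here
        both terms of the recurrence vanish.\<close>
      have "card (fst ` staircase N) \<le> card {..<N}"
        by (intro card_mono) (auto simp: staircase_def)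
      then have "rooks (staircase N) (Suc N) = {}"
        by (intro rooks_eq_empty) (auto simp: finite_staircase)
      then show ?thesis using rec True Suc by simp
    next
      case False
      then have "t' < N" using Suc \<open>t \<le> Suc N\<close> by simp
      then obtain m where m: "N - t' = Suc m" "N - Suc t' = m" by (metis Suc_diff_Suc)
      show ?thesis using rec Suc.IH[of t'] Suc.IH[of "Suc t'"] m \<open>t' < N\<close> Suc
        by (simp add: mult.commute)
    qed
  qed
qed

section \<open>Relabelled boards, and permutations as full placements\<close>

lemma card_rooks_image:
  assumes f: "inj_on f (fst ` B)" and g: "inj_on g (snd ` B)"
  shows "card (rooks (map_prod f g ` B) t) = card (rooks B t)"
proof -
  have inj: "inj_on (map_prod f g) B"
    using f g by (fastforce simp: inj_on_def)
  have *: "inj_on fst (map_prod f g ` M) \<longleftrightarrow> inj_on fst M"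
      "inj_on snd (map_prod f g ` M) \<longleftrightarrow> inj_on snd M"
      "card (map_prod f g ` M) = card M" if "M \<subseteq> B" for M
  proof -
    have iM: "inj_on (map_prod f g) M" using inj that by (rule inj_on_subset)
    then show "card (map_prod f g ` M) = card M" by (rule card_image)
    have "inj_on fst (map_prod f g ` M) \<longleftrightarrow> inj_on (fst \<circ> map_prod f g) M"
      using comp_inj_on_iff[OF iM] by blast
    also have "\<dots> \<longleftrightarrow> inj_on (f \<circ> fst) M" by (simp add: fst_comp_map_prod comp_def)
    also have "\<dots> \<longleftrightarrow> inj_on fst M"
      using f that by (meson comp_inj_on image_mono inj_on_imageI2 inj_on_subset)
    finally show "inj_on fst (map_prod f g ` M) \<longleftrightarrow> inj_on fst M" .
    have "inj_on snd (map_prod f g ` M) \<longleftrightarrow> inj_on (snd \<circ> map_prod f g) M"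
      using comp_inj_on_iff[OF iM] by blast
    also have "\<dots> \<longleftrightarrow> inj_on (g \<circ> snd) M" by (simp add: snd_comp_map_prod comp_def)
    also have "\<dots> \<longleftrightarrow> inj_on snd M"
      using g that by (meson comp_inj_on image_mono inj_on_imageI2 inj_on_subset)
    finally show "inj_on snd (map_prod f g ` M) \<longleftrightarrow> inj_on snd M" .
  qed
  have "rooks (map_prod f g ` B) t = (`) (map_prod f g) ` rooks B t"
  proof (intro equalityI subsetI)
    fix M assume M: "M \<in> rooks (map_prod f g ` B) t"
    then obtain M' where "M' \<subseteq> B" "M = map_prod f g ` M'"
      by (auto simp: rooks_def subset_image_iff)
    then show "M \<in> (`) (map_prod f g) ` rooks B t" using M * by (auto simp: rooks_def)
  qed (use * in \<open>auto simp: rooks_def\<close>)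
  moreover have "inj_on ((`) (map_prod f g)) (rooks B t)"
    by (rule inj_on_subset[OF inj_on_image_Pow[OF inj]]) (auto simp: rooks_def)
  ultimately show ?thesis by (simp add: card_image)
qed

lemma card_rooks_swap:
  fixes B :: "('a \<times> 'b) set"
  shows "card (rooks (prod.swap ` B) t) = card (rooks B t)"
proof -
  have *: "inj_on fst (prod.swap ` M) \<longleftrightarrow> inj_on snd M"
     "inj_on snd (prod.swap ` M) \<longleftrightarrow> inj_on fst M" for M :: "('a \<times> 'b) set"
    by (fastforce simp: inj_on_def)+
  have "rooks (prod.swap ` B) t = (`) prod.swap ` rooks B t"
  proof (intro equalityI subsetI)
    fix M assume M: "M \<in> rooks (prod.swap ` B) t"
    then obtain M' where "M' \<subseteq> B" "M = prod.swap ` M'"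
      by (auto simp: rooks_def subset_image_iff)
    then show "M \<in> (`) prod.swap ` rooks B t" using M * by (auto simp: rooks_def card_image)
  qed (use * in \<open>auto simp: rooks_def card_image\<close>)
  moreover have "inj_on ((`) prod.swap) (rooks B t)"
    by (rule inj_on_subset[OF inj_on_image_Pow[OF inj_swap[of B]]]) (auto simp: rooks_def)
  ultimately show ?thesis by (simp add: card_image)
qed

text \<open>Permutations are identified with their graphs: \<open>card S\<close> rooks inside
  \<open>S \<times> S\<close> fill every row and column, hence form the graph of a
  bijection.\<close>

lemma card_permutes_rooks:
  assumes S: "finite S" and B: "B \<subseteq> S \<times> S"
  shows "card {\<sigma>. \<sigma> permutes S \<and> (\<forall>i\<in>S. (i, \<sigma> i) \<in> B)} = card (rooks B (card S))"
proof -
  let ?g = "\<lambda>\<sigma>. (\<lambda>i. (i, \<sigma> i)) ` S" and ?P = "{\<sigma>. \<sigma> permutes S \<and> (\<forall>i\<in>S. (i, \<sigma> i) \<in> B)}"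
  have "bij_betw ?g ?P (rooks B (card S))"
  proof (rule bij_betw_imageI)
    show "inj_on ?g ?P"
    proof (rule inj_onI)
      fix \<sigma> \<tau> assume *: "\<sigma> \<in> ?P" "\<tau> \<in> ?P" "?g \<sigma> = ?g \<tau>"
      show "\<sigma> = \<tau>"
      proof
        fix i show "\<sigma> i = \<tau> i"
        proof (cases "i \<in> S")
          case True
          then have "(i, \<sigma> i) \<in> ?g \<tau>" using *(3) by blast
          then show ?thesis by auto
        next
          case False
          then show ?thesis using * permutes_not_in[of \<sigma> S i] permutes_not_in[of \<tau> S i] by simp
        qed
      qed
    qed
    show "?g ` ?P = rooks B (card S)"
    proof (intro equalityI subsetI)
      fix M assume "M \<in> ?g ` ?P"
      then obtain \<sigma> where s: "\<sigma> permutes S" "\<forall>i\<in>S. (i, \<sigma> i) \<in> B" "M = ?g \<sigma>" by auto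
      have "inj_on snd M" using permutes_inj[OF s(1)] s(3) by (auto simp: inj_on_def)
      moreover have "card M = card S" unfolding s(3) by (rule card_image) (auto simp: inj_on_def)
      ultimately show "M \<in> rooks B (card S)" using s by (auto simp: rooks_def inj_on_def)
    next
      fix M assume "M \<in> rooks B (card S)"
      then have M: "M \<subseteq> B" "inj_on fst M" "inj_on snd M" "card M = card S" by (auto simp: rooks_def)
      have "fst ` M = S" "snd ` M = S"
        by (rule card_subset_eq[OF S]; use M B in \<open>force simp: card_image\<close>)+
      define \<sigma> where "\<sigma> i = (if i \<in> S then snd (inv_into M fst i) else i)" for i
      have sig: "\<sigma> (fst z) = snd z" if "z \<in> M" for z
        using that M \<open>fst ` M = S\<close> by (auto simp: \<sigma>_def)
      have img: "\<sigma> ` S = S"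
        using sig \<open>fst ` M = S\<close> \<open>snd ` M = S\<close> by (metis (no_types, lifting) image_cong image_image)
      have "bij_betw \<sigma> S S" using img S by (simp add: bij_betw_def eq_card_imp_inj_on)
      then have "\<sigma> permutes S" by (rule bij_imp_permutes) (simp add: \<sigma>_def)
      moreover have "M = ?g \<sigma>"
      proof -
        have "M = (\<lambda>z. (fst z, \<sigma> (fst z))) ` M" using sig by force
        then show ?thesis using \<open>fst ` M = S\<close> by (simp add: image_image flip: \<open>fst ` M = S\<close>)
      qed
      ultimately show "M \<in> ?g ` ?P" using M by blast
    qed
  qed
  then show ?thesis by (rule bij_betw_same_card)
qed

text \<open>Applied to \<open>fst\<close> with row classes \<open>A\<close>, \<open>B\<close>, and
  to \<open>snd\<close> with column classes \<open>E\<close>, \<open>D\<close> and with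
  \<open>M3\<close>, \<open>M4\<close> exchanged.\<close>

lemma inj_on_Un4:
  assumes "inj_on f M1" "inj_on f M2" "inj_on f M3" "inj_on f M4"
    and "f ` M1 \<subseteq> A" "f ` M2 \<subseteq> B" "f ` M3 \<subseteq> A - f ` M1" "f ` M4 \<subseteq> B - f ` M2" "A \<inter> B = {}"
  shows "inj_on f (M1 \<union> M2 \<union> M3 \<union> M4)"
proof -
  have un: "inj_on f (X \<union> Y)" if "inj_on f X" "inj_on f Y" "f ` X \<inter> f ` Y = {}" for X Y
    using that by (auto simp: inj_on_Un)
  have "f ` M1 \<inter> f ` M2 = {}" using assms(5,6,9) by blast
  moreover have "f ` (M1 \<union> M2) \<inter> f ` M3 = {}" using assms(6,7,9) unfolding image_Un by blast
  moreover have "f ` (M1 \<union> M2 \<union> M3) \<inter> f ` M4 = {}"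
    using assms(5,7,8,9) unfolding image_Un by blast
  ultimately show ?thesis using assms(1-4) by (intro un)
qed

text \<open>
  If a full placement has \<open>m\<close> rooks in \<open>A \<times> D\<close>, it has \<open>q - m\<close>, \<open>p - m\<close> and \<open>m\<close> rooks in
  \<open>A \<times> E\<close>, \<open>B \<times> D\<close> and \<open>B \<times> E\<close>. Given the rooks in \<open>B1\<close> and \<open>B2\<close>, the other ones form perfect
  matchings of two complete \<open>m\<close> by \<open>m\<close> boards.
\<close>

lemma card_rooks_block:
  fixes A B :: "'a set" and D E :: "'b set"
  assumes fin: "finite A" "finite B" "finite D" "finite E"
    and disj: "A \<inter> B = {}" "D \<inter> E = {}"
    and card: "card A = q" "card E = q" "card B = p" "card D = p"
    and sub: "B1 \<subseteq> A \<times> E" "B2 \<subseteq> B \<times> D"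
  shows "card (rooks (B1 \<union> B2 \<union> A \<times> D \<union> B \<times> E) (p + q)) =
    (\<Sum>m\<le>min p q. card (rooks B1 (q - m)) * card (rooks B2 (p - m)) * (fact m)^2)"
proof -
  let ?Bd = "B1 \<union> B2 \<union> A \<times> D \<union> B \<times> E"
  let ?F = "\<lambda>m M1 M2. rooks ((A - fst ` M1) \<times> (D - snd ` M2)) m \<times>
      rooks ((B - fst ` M2) \<times> (E - snd ` M1)) m"
  let ?S = "SIGMA m:{..min p q}. SIGMA z:rooks B1 (q - m) \<times> rooks B2 (p - m). ?F m (fst z) (snd z)"
  \<comment> \<open>\<open>?h\<close> glues the four parts together and \<open>?h'\<close> cuts a
    placement along the blocks, recovering \<open>m\<close> as the number of rooks in
    \<open>A \<times> D\<close>.\<close>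
  let ?h = "\<lambda>(m :: nat, (M1, M2), (M3, M4)). M1 \<union> M2 \<union> M3 \<union> M4"
  let ?h' = "\<lambda>M. (card (M \<inter> A \<times> D), (M \<inter> A \<times> E, M \<inter> B \<times> D), (M \<inter> A \<times> D, M \<inter> B \<times> E))"
  have finB: "finite B1" "finite B2" using sub fin by (auto intro: finite_subset)
  have proj: "fst ` M \<subseteq> X" "snd ` M \<subseteq> Y" if "M \<subseteq> X \<times> Y"
    for M :: "('a \<times> 'b) set" and X Y using that by auto
  have "bij_betw ?h ?S (rooks ?Bd (p + q))"
  proof (rule bij_betw_byWitness[where f' = ?h'])
    show "\<forall>x\<in>?S. ?h' (?h x) = x"
    proof
      fix x assume "x \<in> ?S"
      then obtain m M1 M2 M3 M4 where x: "x = (m, (M1, M2), M3, M4)"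
        and "M1 \<in> rooks B1 (q - m)" "M2 \<in> rooks B2 (p - m)" "(M3, M4) \<in> ?F m M1 M2"
        by auto
      then have "M1 \<subseteq> A \<times> E" "M2 \<subseteq> B \<times> D" "M3 \<subseteq> A \<times> D" "M4 \<subseteq> B \<times> E" "card M3 = m"
        using sub by (auto simp: rooks_def)
      moreover from this have "(M1 \<union> M2 \<union> M3 \<union> M4) \<inter> A \<times> D = M3"
          "(M1 \<union> M2 \<union> M3 \<union> M4) \<inter> A \<times> E = M1" "(M1 \<union> M2 \<union> M3 \<union> M4) \<inter> B \<times> D = M2"
          "(M1 \<union> M2 \<union> M3 \<union> M4) \<inter> B \<times> E = M4"
        using disj by auto
      ultimately show "?h' (?h x) = x" by (simp add: x)
    qed
    show "\<forall>M\<in>rooks ?Bd (p + q). ?h (?h' M) = M"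
      using sub by (auto simp: rooks_def)
    show "?h ` ?S \<subseteq> rooks ?Bd (p + q)"
    proof (rule image_subsetI)
      fix x assume "x \<in> ?S"
      then obtain m M1 M2 M3 M4 where x: "x = (m, (M1, M2), M3, M4)" and m: "m \<le> p" "m \<le> q"
        and "M1 \<in> rooks B1 (q - m)" "M2 \<in> rooks B2 (p - m)" "(M3, M4) \<in> ?F m M1 M2"
        by auto
      then have M: "M1 \<in> rooks B1 (q - m)" "M2 \<in> rooks B2 (p - m)"
          "M3 \<in> rooks ((A - fst ` M1) \<times> (D - snd ` M2)) m"
          "M4 \<in> rooks ((B - fst ` M2) \<times> (E - snd ` M1)) m" by auto
      then have s: "M1 \<subseteq> A \<times> E" "M2 \<subseteq> B \<times> D" "M1 \<subseteq> B1" "M2 \<subseteq> B2"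
          "M3 \<subseteq> (A - fst ` M1) \<times> (D - snd ` M2)" "M4 \<subseteq> (B - fst ` M2) \<times> (E - snd ` M1)"
        using sub by (auto simp: rooks_def)
      have f: "finite M1" "finite M2" "finite M3" "finite M4"
        using s fin finB by (auto intro: finite_subset)
      have s': "fst ` M1 \<subseteq> A" "snd ` M1 \<subseteq> E" "fst ` M2 \<subseteq> B" "snd ` M2 \<subseteq> D"
        "fst ` M3 \<subseteq> A - fst ` M1" "snd ` M3 \<subseteq> D - snd ` M2"
        "fst ` M4 \<subseteq> B - fst ` M2" "snd ` M4 \<subseteq> E - snd ` M1"
        using proj[OF s(1)] proj[OF s(2)] proj[OF s(5)] proj[OF s(6)] by auto
      have "M1 \<inter> M2 = {}" "(M1 \<union> M2) \<inter> M3 = {}" "(M1 \<union> M2 \<union> M3) \<inter> M4 = {}"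
        using s disj by auto
      then have "card (M1 \<union> M2 \<union> M3 \<union> M4) = card M1 + card M2 + card M3 + card M4"
        using f by (simp add: card_Un_disjoint)
      then have "card (M1 \<union> M2 \<union> M3 \<union> M4) = p + q" using M m by (auto simp: rooks_def)
      moreover have "M1 \<union> M2 \<union> M3 \<union> M4 \<subseteq> ?Bd" using s by auto
      moreover have "inj_on fst (M1 \<union> M2 \<union> M3 \<union> M4)"
        using M by (intro inj_on_Un4[OF _ _ _ _ s'(1,3,5,7) disj(1)]) (auto simp: rooks_def)
      moreover have "inj_on snd (M1 \<union> M2 \<union> M4 \<union> M3)"
        using M disj(2)
        by (intro inj_on_Un4[OF _ _ _ _ s'(2,4,8,6)]) (auto simp: rooks_def Int_commute)
      then have "inj_on snd (M1 \<union> M2 \<union> M3 \<union> M4)" by (simp add: Un_ac)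
      ultimately show "?h x \<in> rooks ?Bd (p + q)" by (simp add: rooks_def x)
    qed
    show "?h' ` rooks ?Bd (p + q) \<subseteq> ?S"
    proof (rule image_subsetI)
      fix M assume "M \<in> rooks ?Bd (p + q)"
      then have M: "M \<subseteq> ?Bd" "inj_on fst M" "inj_on snd M" "card M = p + q" by (auto simp: rooks_def)
      have finM: "finite M" using M(1) finB fin by (auto intro: finite_subset)
      have sq: "M \<subseteq> (A \<union> B) \<times> (D \<union> E)" using M(1) sub by auto
      \<comment> \<open>There are as many rooks as rows and as columns, so every row and column is
        used.\<close>
      have rows: "fst ` M = A \<union> B"
        by (rule card_subset_eq) (use sq fin M disj card in \<open>auto simp: card_image card_Un_disjoint\<close>)
      have cols: "snd ` M = D \<union> E"
        by (rule card_subset_eq) (use sq fin M disj card in \<open>auto simp: card_image card_Un_disjoint\<close>)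
      have row: "card {z \<in> M. fst z \<in> X} = card X" if "X \<subseteq> A \<union> B" for X
      proof -
        have "fst ` {z \<in> M. fst z \<in> X} = fst ` M \<inter> X" by auto
        then have "fst ` {z \<in> M. fst z \<in> X} = X" using rows that by auto
        moreover have "inj_on fst {z \<in> M. fst z \<in> X}" using M(2) by (rule inj_on_subset) auto
        ultimately show ?thesis by (metis card_image)
      qed
      have col: "card {z \<in> M. snd z \<in> X} = card X" if "X \<subseteq> D \<union> E" for X
      proof -
        have "snd ` {z \<in> M. snd z \<in> X} = snd ` M \<inter> X" by auto
        then have "snd ` {z \<in> M. snd z \<in> X} = X" using cols that by auto
        moreover have "inj_on snd {z \<in> M. snd z \<in> X}" using M(3) by (rule inj_on_subset) auto
        ultimately show ?thesis by (metis card_image)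
      qed
      have split: "{z \<in> M. fst z \<in> A} = (M \<inter> A \<times> E) \<union> (M \<inter> A \<times> D)"
          "{z \<in> M. fst z \<in> B} = (M \<inter> B \<times> D) \<union> (M \<inter> B \<times> E)"
          "{z \<in> M. snd z \<in> D} = (M \<inter> A \<times> D) \<union> (M \<inter> B \<times> D)"
        using sq by auto
      have cards: "card (M \<inter> A \<times> E) + card (M \<inter> A \<times> D) = q"
          "card (M \<inter> B \<times> D) + card (M \<inter> B \<times> E) = p"
          "card (M \<inter> A \<times> D) + card (M \<inter> B \<times> D) = p"
      proof -
        have *: "card (M \<inter> X \<union> M \<inter> Y) = card (M \<inter> X) + card (M \<inter> Y)" if "X \<inter> Y = {}" for X Y
          using finM that by (intro card_Un_disjoint) auto
        have "card {z \<in> M. fst z \<in> A} = card (M \<inter> A \<times> E) + card (M \<inter> A \<times> D)"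
          unfolding split by (rule *) (use disj in auto)
        moreover have "card {z \<in> M. fst z \<in> B} = card (M \<inter> B \<times> D) + card (M \<inter> B \<times> E)"
          unfolding split by (rule *) (use disj in auto)
        moreover have "card {z \<in> M. snd z \<in> D} = card (M \<inter> A \<times> D) + card (M \<inter> B \<times> D)"
          unfolding split by (rule *) (use disj in auto)
        ultimately show "card (M \<inter> A \<times> E) + card (M \<inter> A \<times> D) = q"
            "card (M \<inter> B \<times> D) + card (M \<inter> B \<times> E) = p"
            "card (M \<inter> A \<times> D) + card (M \<inter> B \<times> D) = p"
          using row[of A] row[of B] col[of D] card by simp_all
      qed
      have inj: "inj_on fst (M \<inter> X)" "inj_on snd (M \<inter> X)" for X
        using M by (auto intro: inj_on_subset)
      have excl: "b = b'" if "(a, b) \<in> M" "(a, b') \<in> M" for a b b'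
        using inj_onD[OF M(2) _ that] by simp
      have excl': "a = a'" if "(a, b) \<in> M" "(a', b) \<in> M" for a a' b
        using inj_onD[OF M(3) _ that] by simp
      have "M \<inter> A \<times> E \<subseteq> ?Bd \<inter> A \<times> E" "M \<inter> B \<times> D \<subseteq> ?Bd \<inter> B \<times> D" using M(1) by auto
      moreover have "?Bd \<inter> A \<times> E \<subseteq> B1" "?Bd \<inter> B \<times> D \<subseteq> B2" using sub disj by auto
      ultimately have "M \<inter> A \<times> E \<subseteq> B1" "M \<inter> B \<times> D \<subseteq> B2" by (meson order_trans)+
      moreover have "M \<inter> A \<times> D \<subseteq> (A - fst ` (M \<inter> A \<times> E)) \<times> (D - snd ` (M \<inter> B \<times> D))"
        using disj by (auto dest: excl excl')
      moreover have "M \<inter> B \<times> E \<subseteq> (B - fst ` (M \<inter> B \<times> D)) \<times> (E - snd ` (M \<inter> A \<times> E))"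
        using disj by (auto dest: excl excl')
      ultimately show "?h' M \<in> ?S" using cards inj by (auto simp: rooks_def)
    qed
  qed
  then have "card (rooks ?Bd (p + q)) = card ?S" by (rule bij_betw_same_card[symmetric])
  also have "\<dots> = (\<Sum>m\<le>min p q. \<Sum>z\<in>rooks B1 (q - m) \<times> rooks B2 (p - m). card (?F m (fst z) (snd z)))"
    using finB fin by (simp add: card_SigmaI finite_rooks)
  also have "\<dots> = (\<Sum>m\<le>min p q. \<Sum>z\<in>rooks B1 (q - m) \<times> rooks B2 (p - m). (fact m)^2)"
  proof (intro sum.cong refl)
    fix m z assume m: "m \<in> {..min p q}" and "z \<in> rooks B1 (q - m) \<times> rooks B2 (p - m)"
    then obtain M1 M2 where z: "z = (M1, M2)" "M1 \<in> rooks B1 (q - m)" "M2 \<in> rooks B2 (p - m)" by auto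
    then have M1: "fst ` M1 \<subseteq> A" "snd ` M1 \<subseteq> E" "card (fst ` M1) = q - m" "card (snd ` M1) = q - m"
      and M2: "fst ` M2 \<subseteq> B" "snd ` M2 \<subseteq> D" "card (fst ` M2) = p - m" "card (snd ` M2) = p - m"
      using proj[of M1 A E] proj[of M2 B D] sub by (auto simp: rooks_def card_image)
    have "card (A - fst ` M1) = m" "card (D - snd ` M2) = m"
        "card (B - fst ` M2) = m" "card (E - snd ` M1) = m"
      using M1 M2 fin card m by (auto simp: card_Diff_subset finite_subset)
    then show "card (?F m (fst z) (snd z)) = (fact m)^2"
      using fin z by (simp add: card_cartesian_product card_rooks_square power2_eq_square)
  qed
  finally show ?thesis by (simp add: card_cartesian_product)
qed

section \<open>Permutations in a band\<close>

lemma card_permutes_band: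
  fixes p q :: nat
  defines "n \<equiv> p + q"
  shows "card {\<sigma>. \<sigma> permutes {1..n} \<and> (\<forall>i\<in>{1..n}. i \<le> \<sigma> i + q \<and> \<sigma> i < p + i)} = polyC p q"
proof -
  \<comment> \<open>In \<open>A \<times> D\<close> and \<open>B \<times> E\<close> both inequalities
    are automatic; in \<open>A \<times> E\<close> only \<open>s < p + i\<close> restricts, in
    \<open>B \<times> D\<close> only \<open>i \<le> s + q\<close>.\<close>
  define A B D E where "A = {1..q}" and "B = {q+1..n}" and "D = {1..p}" and "E = {p+1..n}"
  note defs = A_def B_def D_def E_def n_def
  define B1 where "B1 = map_prod (\<lambda>i. i + 1) (\<lambda>j. j + p + 1) ` staircase q"
  \<comment> \<open>Column \<open>s\<close> of this board has \<open>s\<close> cells, so columns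
    play the staircase rows; the size is \<open>p + 1\<close> because row \<open>0\<close> of a
    staircase is empty.\<close>
  define B2 where "B2 = map_prod (\<lambda>i. i + q + 1) id ` prod.swap ` staircase (p + 1)"
  have B1: "(i, s) \<in> B1 \<longleftrightarrow> 1 \<le> i \<and> i \<le> q \<and> p + 1 \<le> s \<and> s < p + i" for i s
  proof
    assume "1 \<le> i \<and> i \<le> q \<and> p + 1 \<le> s \<and> s < p + i"
    then have "(i - 1, s - p - 1) \<in> staircase q" "(i, s) = map_prod (\<lambda>i. i + 1) (\<lambda>j. j + p + 1) (i - 1, s - p - 1)"
      by (auto simp: staircase_def)
    then show "(i, s) \<in> B1" unfolding B1_def by blast
  qed (auto simp: B1_def staircase_def)
  have B2: "(i, s) \<in> B2 \<longleftrightarrow> q + 1 \<le> i \<and> s \<le> p \<and> i \<le> s + q" for i s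
  proof
    assume "q + 1 \<le> i \<and> s \<le> p \<and> i \<le> s + q"
    then have "(s, i - q - 1) \<in> staircase (p + 1)"
        "(i, s) = map_prod (\<lambda>i. i + q + 1) id (prod.swap (s, i - q - 1))"
      by (auto simp: staircase_def)
    then show "(i, s) \<in> B2" unfolding B2_def by blast
  qed (auto simp: B2_def staircase_def)
  let ?Bd = "B1 \<union> B2 \<union> A \<times> D \<union> B \<times> E"
  have sub: "B1 \<subseteq> A \<times> E" "B2 \<subseteq> B \<times> D" by (auto simp: B1 B2 defs)
  have band: "(i, s) \<in> ?Bd \<longleftrightarrow> i \<le> s + q \<and> s < p + i" if "i \<in> {1..n}" "s \<in> {1..n}" for i s
    using that by (auto simp: B1 B2 defs)
  have "{\<sigma>. \<sigma> permutes {1..n} \<and> (\<forall>i\<in>{1..n}. i \<le> \<sigma> i + q \<and> \<sigma> i < p + i)} =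
      {\<sigma>. \<sigma> permutes {1..n} \<and> (\<forall>i\<in>{1..n}. (i, \<sigma> i) \<in> ?Bd)}"
  proof (intro Collect_cong conj_cong refl ball_cong)
    fix \<sigma> i assume "\<sigma> permutes {1..n}" "i \<in> {1..n}"
    moreover from this have "\<sigma> i \<in> {1..n}" by (simp only: permutes_in_image)
    ultimately show "(i \<le> \<sigma> i + q \<and> \<sigma> i < p + i) = ((i, \<sigma> i) \<in> ?Bd)" using band by blast
  qed
  also have "card \<dots> = card (rooks ?Bd (card {1..n}))"
    by (rule card_permutes_rooks) (use sub in \<open>auto simp: defs\<close>)
  also have "\<dots> = card (rooks ?Bd (p + q))" by (simp add: n_def)
  also have "\<dots> = (\<Sum>m\<le>min p q. card (rooks B1 (q - m)) * card (rooks B2 (p - m)) * (fact m)^2)"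
    by (rule card_rooks_block[OF _ _ _ _ _ _ _ _ _ _ sub]) (auto simp: defs)
  also have "\<dots> = polyC p q"
    unfolding polyC_def
  proof (rule sum.cong)
    fix m assume "m \<in> {..min p q}"
    then have m: "m \<le> p" "m \<le> q" by auto
    have "card (rooks B1 (q - m)) = Stirling q m"
      unfolding B1_def using m
      by (subst card_rooks_image) (auto simp: inj_on_def card_rooks_staircase)
    \<comment> \<open>The larger staircase gives \<open>p + 1 - (p - m) = m + 1\<close>, the source
      of the shift in \<open>polyC\<close>.\<close>
    moreover have "card (rooks B2 (p - m)) = Stirling (p + 1) (m + 1)"
      unfolding B2_def using m
      by (subst card_rooks_image) (auto simp: inj_on_def card_rooks_staircase card_rooks_swap Suc_diff_le simp del: Stirling.simps)
    ultimately show "card (rooks B1 (q - m)) * card (rooks B2 (p - m)) * (fact m)^2 =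
        (fact m)^2 * Stirling (p + 1) (m + 1) * Stirling q m" by simp
  qed simp
  finally show ?thesis .
qed

text \<open>Inversion turns bounds on positions into bounds on values, to which
  \<open>card_permutes_band\<close> applies.\<close>

lemma card_inverse_band:
  assumes "p \<le> n"
  shows "card {\<pi>. \<pi> permutes {1..n} \<and>
              (\<forall>i\<in>{1..n}. int p + int i - int n \<le> int (inv \<pi> i) \<and>
                           int (inv \<pi> i) \<le> int p + int i - 1)} = polyC p (n - p)"
    (is "card ?P = _")
proof -
  let ?Q = "{\<sigma>. \<sigma> permutes {1..n} \<and> (\<forall>i\<in>{1..n}. i \<le> \<sigma> i + (n - p) \<and> \<sigma> i < p + i)}"
  have iff: "i \<le> s + (n - p) \<and> s < p + i \<longleftrightarrow> int p + int i - int n \<le> int s \<and> int s \<le> int p + int i - 1"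
    for i s using assms by auto
  have "bij_betw inv ?P ?Q"
    unfolding iff by (rule bij_betw_byWitness[where f' = inv])
      (auto simp: permutes_inv permutes_inv_inv)
  then have "card ?P = card ?Q" by (rule bij_betw_same_card)
  then show ?thesis using card_permutes_band[of p "n - p"] assms by simp
qed

theorem theorem2p8:
  fixes n p :: nat
  assumes "1 \<le> n" and "1 \<le> p" and "p \<le> n"
  shows "(\<forall>\<pi>. \<pi> permutes {1..n} \<longrightarrow>
            (\<pi> \<in> (\<Inter>r\<in>{1..n+1}. T_set n r p) \<longleftrightarrow>
             (\<forall>i\<in>{1..n}. int p + int i - int n \<le> int (inv \<pi> i) \<and>
                           int (inv \<pi> i) \<le> int p + int i - 1)))
       \<and> card {\<pi>. \<pi> permutes {1..n} \<and>
              (\<forall>i\<in>{1..n}. int p + int i - int n \<le> int (inv \<pi> i) \<and>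
                           int (inv \<pi> i) \<le> int p + int i - 1)} = polyC p (n - p)"
  using in_all_T_sets_iff[OF _ assms(2,3)] card_inverse_band[OF assms(3)] by blast

end
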